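(* For every integer $n\ge1$, the sentence $TR^n$ (Hartogs' law of trichotomy for $n$-ary predicates) is HPL-independent from the set $choice_h^{1,1}$ of all 1-1 Ackermann axioms; that is, neither $TR^n$ nor $\neg TR^n$ is a consequence of $choice_h^{1,1}$ in second-order predicate logic with Henkin interpretation.
   Context: Language: second-order formulas (the set $\mathcal{L}^{(2)}$) are built from individual variables, $n$-ary predicate variables for each $n\ge1$ ("variables of sort $n$"), identity between individuals, connectives, and quantifiers over individual variables and over predicate variables of every sort. $\mathcal{L}^{(2)}_{x,D}$ is the set of formulas $H=H(x,D)$ in which the individual variable $x$ and the unary predicate variable $D$ occur only free (i.e. not bound); $H$ may contain further free individual and predicate variables. Structures: for a non-empty set $I$, an $n$-ary predicate on $I$ is a function $\alpha:I^n\to\{true,false\}$, identified with a subset of $I^n$. A predicate structure over $I$ is a sequence $\Sigma=(J_n)_{n\ge0}$ with $J_0=I$ and each $J_n$ ($n\ge1$) a non-empty set of $n$-ary predicates on $I$. Individual variables range over $J_0$ and predicate variables of sort $n$ range over $J_n$. $\Sigma\models\varphi$ means that $\varphi$ is true in $\Sigma$ under every assignment of the variables in $\Sigma$. $\Sigma$ is a Henkin-Asser structure if it satisfies full second-order comprehension: for every formula $H$, all distinct individual variables $x_1,\dots,x_n$ and every assignment $f$, the $n$-ary predicate $\{(\xi_1,\dots,\xi_n)\in I^n\mid H$ is true in $\Sigma$ under $f$ modified by $x_i\mapsto\xi_i\}$ belongs to $J_n$. HPL (second-order predicate logic with Henkin interpretation): $\psi$ is an HPL-consequence of a set $\Gamma$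 of formulas if $\psi$ holds in every Henkin-Asser structure that is a model of $\Gamma$. A sentence $\psi$ is HPL-independent from $\Gamma$ if neither $\psi$ nor $\neg\psi$ is an HPL-consequence of $\Gamma$; equivalently, there are Henkin-Asser structures that are models of $\Gamma\cup\{\psi\}$ and of $\Gamma\cup\{\neg\psi\}$, respectively. Ackermann axioms: $choice_h^{1,1}=\{choice_h^{1,1}(H)\mid H\in\mathcal{L}^{(2)}_{x,D}\}$, where $$choice_h^{1,1}(H)=\ \forall x\,\exists D\,H(x,D)\to\exists S\,\forall x\,\exists D\,\big(\forall y(Dy\leftrightarrow Sxy)\land H(x,D)\big)$$ and $S$ is a binary predicate variable not occurring in $H$. Trichotomy: $TR^n=\forall A\,\forall B\,([A\lesssim B]\lor[B\lesssim A])$, where $A,B$ are variables of sort $n$ and $[A\lesssim B]$ is the second-order formula stating that there is a predicate of sort $2n$ that is (the graph of) a one-to-one function from $A$ into $B$: with $\boldsymbol{x},\boldsymbol{x}',\boldsymbol{y}$ denoting $n$-tuples of individual variables, there is $R$ of sort $2n$ such that for every $\boldsymbol{x}$ with $A\boldsymbol{x}$ there is exactly one $\boldsymbol{y}$ with $B\boldsymbol{y}\land R\boldsymbol{x}\boldsymbol{y}$, and $A\boldsymbol{x}\land A\boldsymbol{x}'\land B\boldsymbol{y}\land R\boldsymbol{x}\boldsymbol{y}\land R\boldsymbol{x}'\boldsymbol{y}$ implies $\boldsymbol{x}=\boldsymbol{x}'$. *)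

theory Defs
  imports Main "HOL-Library.Infinite_Typeclass"
begin

section \<open>Second-order formulas\<close>

text \<open>
  Individual variables are natural numbers; \<open>PVar n i\<close> is the \<open>i\<close>-th predicate variable of
  sort (arity) \<open>n\<close>.  Only sorts \<open>n \<ge> 1\<close> belong to the language, and the number of arguments in an
  atom has to agree with the sort; both requirements are imposed by \<open>wff\<close> below.
\<close>

datatype pvar = PVar (psort: nat) (pindex: nat)

datatype form =
    Eq nat nat
  | Atom pvar "nat list"
  | Neg form
  | And form form
  | Or form form
  | Imp form form
  | Iff form form
  | AllI nat form
  | ExI nat form
  | AllP pvar form
  | ExP pvar form

primrec wff :: "form \<Rightarrow> bool" where
  "wff (Eq x y) \<longleftrightarrow> True"
| "wff (Atom A xs) \<longleftrightarrow> psort A \<ge> 1 \<and> length xs = psort A"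
| "wff (Neg \<phi>) \<longleftrightarrow> wff \<phi>"
| "wff (And \<phi> \<psi>) \<longleftrightarrow> wff \<phi> \<and> wff \<psi>"
| "wff (Or \<phi> \<psi>) \<longleftrightarrow> wff \<phi> \<and> wff \<psi>"
| "wff (Imp \<phi> \<psi>) \<longleftrightarrow> wff \<phi> \<and> wff \<psi>"
| "wff (Iff \<phi> \<psi>) \<longleftrightarrow> wff \<phi> \<and> wff \<psi>"
| "wff (AllI x \<phi>) \<longleftrightarrow> wff \<phi>"
| "wff (ExI x \<phi>) \<longleftrightarrow> wff \<phi>"
| "wff (AllP A \<phi>) \<longleftrightarrow> psort A \<ge> 1 \<and> wff \<phi>"
| "wff (ExP A \<phi>) \<longleftrightarrow> psort A \<ge> 1 \<and> wff \<phi>"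

definition L2 :: "form set" where
  "L2 = {\<phi>. wff \<phi>}"

primrec free_ivars :: "form \<Rightarrow> nat set" where
  "free_ivars (Eq x y) = {x, y}"
| "free_ivars (Atom A xs) = set xs"
| "free_ivars (Neg \<phi>) = free_ivars \<phi>"
| "free_ivars (And \<phi> \<psi>) = free_ivars \<phi> \<union> free_ivars \<psi>"
| "free_ivars (Or \<phi> \<psi>) = free_ivars \<phi> \<union> free_ivars \<psi>"
| "free_ivars (Imp \<phi> \<psi>) = free_ivars \<phi> \<union> free_ivars \<psi>"
| "free_ivars (Iff \<phi> \<psi>) = free_ivars \<phi> \<union> free_ivars \<psi>"
| "free_ivars (AllI x \<phi>) = free_ivars \<phi> - {x}"
| "free_ivars (ExI x \<phi>) = free_ivars \<phi> - {x}"
| "free_ivars (AllP A \<phi>) = free_ivars \<phi>"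
| "free_ivars (ExP A \<phi>) = free_ivars \<phi>"

primrec free_pvars :: "form \<Rightarrow> pvar set" where
  "free_pvars (Eq x y) = {}"
| "free_pvars (Atom A xs) = {A}"
| "free_pvars (Neg \<phi>) = free_pvars \<phi>"
| "free_pvars (And \<phi> \<psi>) = free_pvars \<phi> \<union> free_pvars \<psi>"
| "free_pvars (Or \<phi> \<psi>) = free_pvars \<phi> \<union> free_pvars \<psi>"
| "free_pvars (Imp \<phi> \<psi>) = free_pvars \<phi> \<union> free_pvars \<psi>"
| "free_pvars (Iff \<phi> \<psi>) = free_pvars \<phi> \<union> free_pvars \<psi>"
| "free_pvars (AllI x \<phi>) = free_pvars \<phi>"
| "free_pvars (ExI x \<phi>) = free_pvars \<phi>"
| "free_pvars (AllP A \<phi>) = free_pvars \<phi> - {A}"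
| "free_pvars (ExP A \<phi>) = free_pvars \<phi> - {A}"

primrec bound_ivars :: "form \<Rightarrow> nat set" where
  "bound_ivars (Eq x y) = {}"
| "bound_ivars (Atom A xs) = {}"
| "bound_ivars (Neg \<phi>) = bound_ivars \<phi>"
| "bound_ivars (And \<phi> \<psi>) = bound_ivars \<phi> \<union> bound_ivars \<psi>"
| "bound_ivars (Or \<phi> \<psi>) = bound_ivars \<phi> \<union> bound_ivars \<psi>"
| "bound_ivars (Imp \<phi> \<psi>) = bound_ivars \<phi> \<union> bound_ivars \<psi>"
| "bound_ivars (Iff \<phi> \<psi>) = bound_ivars \<phi> \<union> bound_ivars \<psi>"
| "bound_ivars (AllI x \<phi>) = insert x (bound_ivars \<phi>)"
| "bound_ivars (ExI x \<phi>) = insert x (bound_ivars \<phi>)"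
| "bound_ivars (AllP A \<phi>) = bound_ivars \<phi>"
| "bound_ivars (ExP A \<phi>) = bound_ivars \<phi>"

primrec bound_pvars :: "form \<Rightarrow> pvar set" where
  "bound_pvars (Eq x y) = {}"
| "bound_pvars (Atom A xs) = {}"
| "bound_pvars (Neg \<phi>) = bound_pvars \<phi>"
| "bound_pvars (And \<phi> \<psi>) = bound_pvars \<phi> \<union> bound_pvars \<psi>"
| "bound_pvars (Or \<phi> \<psi>) = bound_pvars \<phi> \<union> bound_pvars \<psi>"
| "bound_pvars (Imp \<phi> \<psi>) = bound_pvars \<phi> \<union> bound_pvars \<psi>"
| "bound_pvars (Iff \<phi> \<psi>) = bound_pvars \<phi> \<union> bound_pvars \<psi>"
| "bound_pvars (AllI x \<phi>) = bound_pvars \<phi>"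
| "bound_pvars (ExI x \<phi>) = bound_pvars \<phi>"
| "bound_pvars (AllP A \<phi>) = insert A (bound_pvars \<phi>)"
| "bound_pvars (ExP A \<phi>) = insert A (bound_pvars \<phi>)"

definition sentence :: "form \<Rightarrow> bool" where
  "sentence \<phi> \<longleftrightarrow> \<phi> \<in> L2 \<and> free_ivars \<phi> = {} \<and> free_pvars \<phi> = {}"


section \<open>Henkin semantics\<close>

text \<open>
  An \<open>n\<close>-ary predicate on \<open>I\<close> is a set of lists of length \<open>n\<close> over \<open>I\<close>.  The component \<open>J\<^sub>0 = I\<close> of a
  predicate structure is the field \<open>indiv\<close>; \<open>J\<^sub>n\<close> is \<open>preds M n\<close> for \<open>n \<ge> 1\<close>, and
  \<open>preds M 0\<close> is never used.
\<close>

record 'a pstruct =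
  indiv :: "'a set"
  preds :: "nat \<Rightarrow> 'a list set set"

definition tuples :: "'a set \<Rightarrow> nat \<Rightarrow> 'a list set" where
  "tuples I n = {\<xi>. length \<xi> = n \<and> set \<xi> \<subseteq> I}"

definition predicate_structure :: "'a pstruct \<Rightarrow> bool" where
  "predicate_structure M \<longleftrightarrow>
     indiv M \<noteq> {} \<and> (\<forall>n\<ge>1. preds M n \<noteq> {} \<and> preds M n \<subseteq> Pow (tuples (indiv M) n))"

definition assignment :: "'a pstruct \<Rightarrow> (nat \<Rightarrow> 'a) \<Rightarrow> (pvar \<Rightarrow> 'a list set) \<Rightarrow> bool" where
  "assignment M e p \<longleftrightarrow>
     (\<forall>x. e x \<in> indiv M) \<and> (\<forall>A. psort A \<ge> 1 \<longrightarrow> p A \<in> preds M (psort A))"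

primrec sat :: "'a pstruct \<Rightarrow> (nat \<Rightarrow> 'a) \<Rightarrow> (pvar \<Rightarrow> 'a list set) \<Rightarrow> form \<Rightarrow> bool" where
  "sat M e p (Eq x y) \<longleftrightarrow> e x = e y"
| "sat M e p (Atom A xs) \<longleftrightarrow> map e xs \<in> p A"
| "sat M e p (Neg \<phi>) \<longleftrightarrow> \<not> sat M e p \<phi>"
| "sat M e p (And \<phi> \<psi>) \<longleftrightarrow> sat M e p \<phi> \<and> sat M e p \<psi>"
| "sat M e p (Or \<phi> \<psi>) \<longleftrightarrow> sat M e p \<phi> \<or> sat M e p \<psi>"
| "sat M e p (Imp \<phi> \<psi>) \<longleftrightarrow> (sat M e p \<phi> \<longrightarrow> sat M e p \<psi>)"
| "sat M e p (Iff \<phi> \<psi>) \<longleftrightarrow> (sat M e p \<phi> \<longleftrightarrow> sat M e p \<psi>)"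
| "sat M e p (AllI x \<phi>) \<longleftrightarrow> (\<forall>a\<in>indiv M. sat M (e(x := a)) p \<phi>)"
| "sat M e p (ExI x \<phi>) \<longleftrightarrow> (\<exists>a\<in>indiv M. sat M (e(x := a)) p \<phi>)"
| "sat M e p (AllP A \<phi>) \<longleftrightarrow> (\<forall>\<alpha>\<in>preds M (psort A). sat M e (p(A := \<alpha>)) \<phi>)"
| "sat M e p (ExP A \<phi>) \<longleftrightarrow> (\<exists>\<alpha>\<in>preds M (psort A). sat M e (p(A := \<alpha>)) \<phi>)"

definition models :: "'a pstruct \<Rightarrow> form \<Rightarrow> bool" (infix "\<Turnstile>" 50) where
  "M \<Turnstile> \<phi> \<longleftrightarrow> (\<forall>e p. assignment M e p \<longrightarrow> sat M e p \<phi>)"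

fun upds :: "(nat \<Rightarrow> 'a) \<Rightarrow> nat list \<Rightarrow> 'a list \<Rightarrow> nat \<Rightarrow> 'a" where
  "upds e (x # xs) (a # as) = upds (e(x := a)) xs as"
| "upds e _ _ = e"

definition henkin_asser :: "'a pstruct \<Rightarrow> bool" where
  "henkin_asser M \<longleftrightarrow> predicate_structure M \<and>
     (\<forall>H\<in>L2. \<forall>xs e p. xs \<noteq> [] \<longrightarrow> distinct xs \<longrightarrow> assignment M e p \<longrightarrow>
        {\<xi> \<in> tuples (indiv M) (length xs). sat M (upds e xs \<xi>) p H} \<in> preds M (length xs))"

text \<open>
  HOL cannot quantify over all types inside a formula, so the type from which the individuals are
  drawn is a parameter; the individual domain \<open>indiv M\<close> ranges over all its non-empty subsets.
  For infinite \<open>'a\<close> this parameter is immaterial: HPL is a many-sorted first-order logic over a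
  countable language, so by the downward Loewenheim-Skolem theorem any failure of a consequence is
  already witnessed by a Henkin-Asser structure with a countable domain.
\<close>

definition hpl_consequence :: "'a itself \<Rightarrow> form set \<Rightarrow> form \<Rightarrow> bool" where
  "hpl_consequence (_ :: 'a itself) \<Gamma> \<psi> \<longleftrightarrow>
     (\<forall>M :: 'a pstruct. henkin_asser M \<and> (\<forall>\<gamma>\<in>\<Gamma>. M \<Turnstile> \<gamma>) \<longrightarrow> M \<Turnstile> \<psi>)"

definition hpl_independent :: "'a itself \<Rightarrow> form set \<Rightarrow> form \<Rightarrow> bool" where
  "hpl_independent U \<Gamma> \<psi> \<longleftrightarrow>
     sentence \<psi> \<and> \<not> hpl_consequence U \<Gamma> \<psi> \<and> \<not> hpl_consequence U \<Gamma> (Neg \<psi>)"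


section \<open>The 1-1 Ackermann axioms\<close>

definition L2_xD :: "nat \<Rightarrow> pvar \<Rightarrow> form set" where
  "L2_xD x D = {H \<in> L2. x \<notin> bound_ivars H \<and> D \<notin> bound_pvars H}"

definition choice_formula :: "nat \<Rightarrow> pvar \<Rightarrow> nat \<Rightarrow> pvar \<Rightarrow> form \<Rightarrow> form" where
  "choice_formula x D y S H =
     Imp (AllI x (ExP D H))
       (ExP S (AllI x (ExP D (And (AllI y (Iff (Atom D [y]) (Atom S [x, y]))) H))))"

text \<open>
  All choices of the variables \<open>x\<close>, \<open>D\<close>, \<open>y\<close>, \<open>S\<close> are admitted, so the set contains every
  alphabetic variant of each axiom.
\<close>

definition choice_h11 :: "form set" where
  "choice_h11 =
     {choice_formula x D y S H | x D y S H.
        psort D = 1 \<and> psort S = 2 \<and> y \<noteq> x \<and>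
        H \<in> L2_xD x D \<and> S \<notin> free_pvars H \<union> bound_pvars H}"


section \<open>Trichotomy\<close>

definition Alls :: "nat list \<Rightarrow> form \<Rightarrow> form" where
  "Alls xs \<phi> = foldr AllI xs \<phi>"

definition Exs :: "nat list \<Rightarrow> form \<Rightarrow> form" where
  "Exs xs \<phi> = foldr ExI xs \<phi>"

fun Conj :: "form list \<Rightarrow> form" where
  "Conj [] = AllI 0 (Eq 0 0)"
| "Conj [\<phi>] = \<phi>"
| "Conj (\<phi> # \<psi> # \<phi>s) = And \<phi> (Conj (\<psi> # \<phi>s))"

definition Eqs :: "nat list \<Rightarrow> nat list \<Rightarrow> form" where
  "Eqs xs ys = Conj (map2 Eq xs ys)"

text \<open>There is exactly one tuple \<open>ys\<close> with \<open>\<Phi> ys\<close>; \<open>zs\<close> is an auxiliary tuple of fresh variables.\<close>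

definition Ex1s :: "nat list \<Rightarrow> nat list \<Rightarrow> (nat list \<Rightarrow> form) \<Rightarrow> form" where
  "Ex1s ys zs \<Phi> = Exs ys (And (\<Phi> ys) (Alls zs (Imp (\<Phi> zs) (Eqs zs ys))))"

text \<open>
  \<open>A\<close> and \<open>B\<close> are meant to be of sort \<open>n \<ge> 1\<close>, hence distinct from \<open>R\<close>, which is of sort \<open>2n\<close>.
\<close>

definition lesssim :: "nat \<Rightarrow> pvar \<Rightarrow> pvar \<Rightarrow> form" where
  "lesssim n A B =
     (let R = PVar (2 * n) 0;
          xs = [0..<n]; xs' = [n..<2 * n]; ys = [2 * n..<3 * n]; zs = [3 * n..<4 * n]
      in ExP R (And
           (Alls xs (Imp (Atom A xs)
              (Ex1s ys zs (\<lambda>us. And (Atom B us) (Atom R (xs @ us))))))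
           (Alls xs (Alls xs' (Alls ys
              (Imp (Conj [Atom A xs, Atom A xs', Atom B ys, Atom R (xs @ ys), Atom R (xs' @ ys)])
                 (Eqs xs xs')))))))"

definition TR :: "nat \<Rightarrow> form" where
  "TR n = (let A = PVar n 0; B = PVar n 1 in
     AllP A (AllP B (Or (lesssim n A B) (lesssim n B A))))"


section \<open>Well-formedness of the axioms and the meaning of trichotomy\<close>

lemma wff_quant [simp]:
  "wff (Alls xs \<phi>) \<longleftrightarrow> wff \<phi>" "wff (Exs xs \<phi>) \<longleftrightarrow> wff \<phi>"
  by (induction xs) (auto simp: Alls_def Exs_def)

lemma free_ivars_quant [simp]:
  "free_ivars (Alls xs \<phi>) = free_ivars \<phi> - set xs"
  "free_ivars (Exs xs \<phi>) = free_ivars \<phi> - set xs"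
  by (induction xs) (auto simp: Alls_def Exs_def)

lemma free_pvars_quant [simp]:
  "free_pvars (Alls xs \<phi>) = free_pvars \<phi>" "free_pvars (Exs xs \<phi>) = free_pvars \<phi>"
  by (induction xs) (auto simp: Alls_def Exs_def)

lemma Conj_simps [simp]:
  "wff (Conj \<phi>s) \<longleftrightarrow> (\<forall>\<phi>\<in>set \<phi>s. wff \<phi>)"
  "free_ivars (Conj \<phi>s) = (\<Union>\<phi>\<in>set \<phi>s. free_ivars \<phi>)"
  "free_pvars (Conj \<phi>s) = (\<Union>\<phi>\<in>set \<phi>s. free_pvars \<phi>)"
  by (induction \<phi>s rule: Conj.induct) auto

lemma sat_Conj [simp]:
  "indiv M \<noteq> {} \<Longrightarrow> sat M e p (Conj \<phi>s) \<longleftrightarrow> (\<forall>\<phi>\<in>set \<phi>s. sat M e p \<phi>)"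
  by (induction \<phi>s rule: Conj.induct) auto

lemma Eqs_simps [simp]:
  "wff (Eqs xs ys)"
  "free_ivars (Eqs xs ys) \<subseteq> set xs \<union> set ys"
  "free_pvars (Eqs xs ys) = {}"
  by (auto simp: Eqs_def dest: set_zip_leftD set_zip_rightD)

lemma sat_Eqs:
  assumes "indiv M \<noteq> {}" "length xs = length ys"
  shows "sat M e p (Eqs xs ys) \<longleftrightarrow> map e xs = map e ys"
proof -
  have "(\<forall>(x, y)\<in>set (zip xs ys). e x = e y) \<longleftrightarrow> map e xs = map e ys"
    using assms(2) by (induction xs ys rule: list_induct2) auto
  then show ?thesis using assms(1) by (auto simp: Eqs_def)
qed

lemma sentence_TR:
  assumes "n \<ge> 1"
  shows "sentence (TR n)"
proof -
  have "wff (lesssim n (PVar n i) (PVar n j))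
      \<and> free_ivars (lesssim n (PVar n i) (PVar n j)) = {}
      \<and> free_pvars (lesssim n (PVar n i) (PVar n j)) \<subseteq> {PVar n i, PVar n j}" for i j
    using assms Eqs_simps(2)[of "[3 * n..<4 * n]" "[2 * n..<3 * n]"]
      Eqs_simps(2)[of "[0..<n]" "[n..<2 * n]"]
    by (auto simp: lesssim_def Let_def Ex1s_def)
  then show ?thesis
    using assms by (fastforce simp: TR_def Let_def sentence_def L2_def)
qed

lemma choice_h11_subset_L2: "choice_h11 \<subseteq> L2"
  by (auto simp: choice_h11_def choice_formula_def L2_xD_def L2_def)

lemma sat_Alls [simp]:
  "sat M e p (Alls xs \<phi>) \<longleftrightarrow> (\<forall>\<xi>\<in>tuples (indiv M) (length xs). sat M (upds e xs \<xi>) p \<phi>)"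
proof (induction xs arbitrary: e)
  case Nil
  show ?case by (simp add: Alls_def tuples_def)
next
  case (Cons x xs)
  have "tuples (indiv M) (length (x # xs)) =
      (\<Union>a\<in>indiv M. (#) a ` tuples (indiv M) (length xs))"
    by (auto simp: tuples_def length_Suc_conv image_iff)
  then show ?case using Cons.IH by (simp add: Alls_def fun_upd_def)
qed

lemma sat_Exs [simp]:
  "sat M e p (Exs xs \<phi>) \<longleftrightarrow> (\<exists>\<xi>\<in>tuples (indiv M) (length xs). sat M (upds e xs \<xi>) p \<phi>)"
proof (induction xs arbitrary: e)
  case Nil
  show ?case by (simp add: Exs_def tuples_def)
next
  case (Cons x xs)
  have "tuples (indiv M) (length (x # xs)) =
      (\<Union>a\<in>indiv M. (#) a ` tuples (indiv M) (length xs))"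
    by (auto simp: tuples_def length_Suc_conv image_iff)
  then show ?case using Cons.IH by (simp add: Exs_def fun_upd_def)
qed

lemma upds_other: "y \<notin> set xs \<Longrightarrow> upds e xs \<xi> y = e y"
  by (induction e xs \<xi> rule: upds.induct) auto

lemma map_upds_other:
  "set ys \<inter> set xs = {} \<Longrightarrow> map (upds e xs \<xi>) ys = map e ys"
  by (auto intro!: upds_other)

lemma map_upds_same:
  "distinct xs \<Longrightarrow> length \<xi> = length xs \<Longrightarrow> map (upds e xs \<xi>) xs = \<xi>"
  by (induction e xs \<xi> rule: upds.induct) (auto simp: upds_other)

definition embeds :: "'a pstruct \<Rightarrow> nat \<Rightarrow> 'a list set \<Rightarrow> 'a list set \<Rightarrow> bool" where
  "embeds M n \<alpha> \<beta> \<longleftrightarrow> (\<exists>\<rho>\<in>preds M (2 * n).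
     (\<forall>\<xi>\<in>\<alpha>. \<exists>!\<eta>. \<eta> \<in> \<beta> \<and> \<xi> @ \<eta> \<in> \<rho>) \<and>
     (\<forall>\<xi>\<in>\<alpha>. \<forall>\<xi>'\<in>\<alpha>. \<forall>\<eta>\<in>\<beta>. \<xi> @ \<eta> \<in> \<rho> \<and> \<xi>' @ \<eta> \<in> \<rho> \<longrightarrow> \<xi> = \<xi>'))"

lemma sat_lesssim:
  assumes "indiv M \<noteq> {}" "n \<ge> 1" "psort A = n" "psort B = n"
    and "p A \<subseteq> tuples (indiv M) n" "p B \<subseteq> tuples (indiv M) n"
  shows "sat M e p (lesssim n A B) \<longleftrightarrow> embeds M n (p A) (p B)"
proof -
  have ne: "A \<noteq> PVar (2 * n) 0" "B \<noteq> PVar (2 * n) 0"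
    using assms(2-4) by (cases A; cases B; simp)+
  have len: "length \<xi> = n" if "\<xi> \<in> tuples (indiv M) n" for \<xi>
    using that by (simp add: tuples_def)
  have 1: "(\<forall>\<xi>\<in>tuples (indiv M) n. \<xi> \<in> p A \<longrightarrow>
        (\<exists>\<eta>\<in>tuples (indiv M) n. (\<eta> \<in> p B \<and> \<xi> @ \<eta> \<in> \<rho>) \<and>
           (\<forall>\<zeta>\<in>tuples (indiv M) n. \<zeta> \<in> p B \<and> \<xi> @ \<zeta> \<in> \<rho> \<longrightarrow> \<zeta> = \<eta>))) \<longleftrightarrow>
      (\<forall>\<xi>\<in>p A. \<exists>!\<eta>. \<eta> \<in> p B \<and> \<xi> @ \<eta> \<in> \<rho>)" for \<rho>
    using assms(5,6) by (smt (verit, ccfv_SIG) subset_iff)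
  have 2: "(\<forall>\<xi>\<in>tuples (indiv M) n. \<forall>\<xi>'\<in>tuples (indiv M) n. \<forall>\<eta>\<in>tuples (indiv M) n.
        \<xi> \<in> p A \<and> \<xi>' \<in> p A \<and> \<eta> \<in> p B \<and> \<xi> @ \<eta> \<in> \<rho> \<and> \<xi>' @ \<eta> \<in> \<rho> \<longrightarrow> \<xi> = \<xi>') \<longleftrightarrow>
      (\<forall>\<xi>\<in>p A. \<forall>\<xi>'\<in>p A. \<forall>\<eta>\<in>p B. \<xi> @ \<eta> \<in> \<rho> \<and> \<xi>' @ \<eta> \<in> \<rho> \<longrightarrow> \<xi> = \<xi>')" for \<rho>
    using assms(5,6) by blast
  have lens: "length [n..<2 * n] = n" "length [2 * n..<3 * n] = n" "length [3 * n..<4 * n] = n"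
    by auto
  show ?thesis
    unfolding embeds_def 1[symmetric] 2[symmetric]
    using assms(1) ne
    by (simp add: lesssim_def Let_def Ex1s_def sat_Eqs map_upds_other map_upds_same len lens
        del: upt_Suc cong: ball_cong bex_cong)
qed

lemma sat_TR:
  assumes "predicate_structure M" "n \<ge> 1"
  shows "sat M e p (TR n) \<longleftrightarrow>
    (\<forall>\<alpha>\<in>preds M n. \<forall>\<beta>\<in>preds M n. embeds M n \<alpha> \<beta> \<or> embeds M n \<beta> \<alpha>)"
  using assms by (auto simp: TR_def Let_def sat_lesssim predicate_structure_def subset_iff)

end

theory Submission
  imports Defs "HOL-Combinatorics.Transposition"
begin

text \<open>
  In the full structure over a single individual choice and trichotomy are trivial.  For the
  independence in the other direction, colour the individuals with two colours, each used infinitely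
  often, and admit exactly the predicates with a finite support, i.e. those invariant under all
  transpositions of equally coloured individuals outside some finite set.  Truth is invariant under
  such transpositions, which gives comprehension.  An injection between the two colour classes
  cannot have a finite support, so trichotomy fails.  Choice holds since a witness \<open>\<delta>\<close> for
  one individual \<open>r\<close> can be transported to almost all individuals \<open>a\<close> of the same colour
  by the transposition of \<open>r\<close> and \<open>a\<close>; the remaining finitely many individuals may be
  treated by arbitrary choices.
\<close>

section \<open>Invariance of truth under automorphisms\<close>

text \<open>Injectivity holds on the whole type and invariance in every sort, 0 included, so truth
  can be transported along arbitrary \<open>e\<close> and \<open>p\<close>, for formulas that need
  not be well-formed.\<close>

definition automorphism :: "'a pstruct \<Rightarrow> ('a \<Rightarrow> 'a) \<Rightarrow> bool" where
  "automorphism M \<pi> \<longleftrightarrow> inj \<pi> \<and> \<pi> ` indiv M = indiv M \<and>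
     (\<forall>n. (`) (map \<pi>) ` preds M n = preds M n)"

lemma automorphism_id: "automorphism M id"
  by (simp add: automorphism_def)

text \<open>Induction on the formula: every quantifier range is its own image under
  \<open>\<pi>\<close>, so a value and its image can be matched. Values are compared on free
  variables only, so \<open>\<pi> = id\<close> yields the coincidence lemma
  \<open>sat_cong\<close>.\<close>

lemma sat_automorphism:
  assumes "automorphism M \<pi>"
    and "\<And>x. x \<in> free_ivars \<phi> \<Longrightarrow> e' x = \<pi> (e x)"
    and "\<And>A. A \<in> free_pvars \<phi> \<Longrightarrow> p' A = map \<pi> ` p A"
  shows "sat M e' p' \<phi> \<longleftrightarrow> sat M e p \<phi>"
  using assms(2,3)
proof (induction \<phi> arbitrary: e p e' p')
  case (Eq x y)
  then show ?case using assms(1) by (simp add: automorphism_def inj_eq)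
next
  case (Atom A xs)
  then have "map e' xs = map \<pi> (map e xs)" "p' A = map \<pi> ` p A" by simp_all
  moreover have "inj (map \<pi>)" using assms(1) by (simp add: automorphism_def)
  ultimately show ?case by (simp add: inj_image_mem_iff del: map_map)
next
  case (AllI x \<phi>)
  have "sat M (e'(x := \<pi> a)) p' \<phi> \<longleftrightarrow> sat M (e(x := a)) p \<phi>" for a
    using AllI.prems by (intro AllI.IH) auto
  then have "(\<forall>a\<in>\<pi> ` indiv M. sat M (e'(x := a)) p' \<phi>) \<longleftrightarrow>
      (\<forall>a\<in>indiv M. sat M (e(x := a)) p \<phi>)" by simp
  moreover have "\<pi> ` indiv M = indiv M" using assms(1) by (simp add: automorphism_def)
  ultimately show ?case by (simp only: sat.simps)
next
  case (ExI x \<phi>)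
  have "sat M (e'(x := \<pi> a)) p' \<phi> \<longleftrightarrow> sat M (e(x := a)) p \<phi>" for a
    using ExI.prems by (intro ExI.IH) auto
  then have "(\<exists>a\<in>\<pi> ` indiv M. sat M (e'(x := a)) p' \<phi>) \<longleftrightarrow>
      (\<exists>a\<in>indiv M. sat M (e(x := a)) p \<phi>)" by simp
  moreover have "\<pi> ` indiv M = indiv M" using assms(1) by (simp add: automorphism_def)
  ultimately show ?case by (simp only: sat.simps)
next
  case (AllP A \<phi>)
  have "sat M e' (p'(A := map \<pi> ` \<alpha>)) \<phi> \<longleftrightarrow> sat M e (p(A := \<alpha>)) \<phi>" for \<alpha>
    using AllP.prems by (intro AllP.IH) auto
  then have "(\<forall>\<alpha>\<in>(`) (map \<pi>) ` preds M (psort A). sat M e' (p'(A := \<alpha>)) \<phi>) \<longleftrightarrow>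
      (\<forall>\<alpha>\<in>preds M (psort A). sat M e (p(A := \<alpha>)) \<phi>)" by simp
  moreover have "(`) (map \<pi>) ` preds M (psort A) = preds M (psort A)"
    using assms(1) by (simp add: automorphism_def)
  ultimately show ?case by (simp only: sat.simps)
next
  case (ExP A \<phi>)
  have "sat M e' (p'(A := map \<pi> ` \<alpha>)) \<phi> \<longleftrightarrow> sat M e (p(A := \<alpha>)) \<phi>" for \<alpha>
    using ExP.prems by (intro ExP.IH) auto
  then have "(\<exists>\<alpha>\<in>(`) (map \<pi>) ` preds M (psort A). sat M e' (p'(A := \<alpha>)) \<phi>) \<longleftrightarrow>
      (\<exists>\<alpha>\<in>preds M (psort A). sat M e (p(A := \<alpha>)) \<phi>)" by simp
  moreover have "(`) (map \<pi>) ` preds M (psort A) = preds M (psort A)"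
    using assms(1) by (simp add: automorphism_def)
  ultimately show ?case by (simp only: sat.simps)
next
  case (Neg \<phi>)
  show ?case using Neg.IH[of e' e p' p] Neg.prems by simp
next
  case (And \<phi> \<psi>)
  show ?case using And.IH[of e' e p' p] And.prems by simp
next
  case (Or \<phi> \<psi>)
  show ?case using Or.IH[of e' e p' p] Or.prems by simp
next
  case (Imp \<phi> \<psi>)
  show ?case using Imp.IH[of e' e p' p] Imp.prems by simp
next
  case (Iff \<phi> \<psi>)
  show ?case using Iff.IH[of e' e p' p] Iff.prems by simp
qed

lemma sat_cong:
  assumes "\<And>x. x \<in> free_ivars \<phi> \<Longrightarrow> e' x = e x" "\<And>A. A \<in> free_pvars \<phi> \<Longrightarrow> p' A = p A"
  shows "sat M e' p' \<phi> \<longleftrightarrow> sat M e p \<phi>"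
  using assms by (intro sat_automorphism[OF automorphism_id]) auto

lemma finite_free_ivars: "finite (free_ivars \<phi>)"
  by (induction \<phi>) auto

lemma finite_free_pvars: "finite (free_pvars \<phi>)"
  by (induction \<phi>) auto

lemma psort_free_pvars: "wff \<phi> \<Longrightarrow> A \<in> free_pvars \<phi> \<Longrightarrow> psort A \<ge> 1"
  by (induction \<phi>) auto

text \<open>The disjunct \<open>x \<in> set xs\<close> covers variables overwritten by the tuple,
  where \<open>e\<close> and \<open>e'\<close> may be unrelated.\<close>

lemma upds_map:
  "length \<xi> = length xs \<Longrightarrow> e' x = \<pi> (e x) \<or> x \<in> set xs \<Longrightarrow>
    upds e' xs (map \<pi> \<xi>) x = \<pi> (upds e xs \<xi> x)"
proof (induction xs \<xi> arbitrary: e e' rule: list_induct2')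
  case (4 y xs a \<xi>)
  show ?case using 4 by (auto intro!: "4.IH")
qed auto

text \<open>Strips the syntax from the axioms. \<open>\<Phi>\<close> comes with a defining equation,
  so a user may treat it as an arbitrary relation and unfold it only to exploit invariance of
  truth.\<close>

lemma models_choice_h11I:
  assumes "\<And>\<Phi> H e p x D. \<lbrakk>assignment M e p; psort D = 1; H \<in> L2;
      \<Phi> = (\<lambda>a \<delta>. sat M (e(x := a)) (p(D := \<delta>)) H);
      \<forall>a\<in>indiv M. \<exists>\<delta>\<in>preds M 1. \<Phi> a \<delta>\<rbrakk> \<Longrightarrow>
      \<exists>\<sigma>\<in>preds M 2. \<forall>a\<in>indiv M. \<exists>\<delta>\<in>preds M 1.
        (\<forall>b\<in>indiv M. [b] \<in> \<delta> \<longleftrightarrow> [a, b] \<in> \<sigma>) \<and> \<Phi> a \<delta>"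
    and "\<gamma> \<in> choice_h11"
  shows "M \<Turnstile> \<gamma>"
proof -
  obtain x D y S H where \<gamma>: "\<gamma> = choice_formula x D y S H" "psort D = 1" "psort S = 2" "y \<noteq> x"
      "H \<in> L2_xD x D" "S \<notin> free_pvars H"
    using assms(2) by (auto simp: choice_h11_def)
  have "sat M e p \<gamma>" if "assignment M e p" for e p
  proof -
    have "D \<noteq> S" using \<gamma>(2,3) by auto
    moreover have "sat M e' (p(S := \<sigma>, D := \<delta>)) H \<longleftrightarrow> sat M e' (p(D := \<delta>)) H" for e' \<sigma> \<delta>
      using \<gamma>(6) by (intro sat_cong) auto
    ultimately show ?thesis
      using assms(1)[OF that \<gamma>(2) _ refl, of H x] \<gamma> by (simp add: choice_formula_def L2_xD_def)
  qed
  then show ?thesis by (simp add: models_def)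
qed

section \<open>The full structure over one individual\<close>

definition full_structure :: "'a set \<Rightarrow> 'a pstruct" where
  "full_structure I = \<lparr>indiv = I, preds = \<lambda>n. Pow (tuples I n)\<rparr>"

lemma henkin_asser_full_structure: "I \<noteq> {} \<Longrightarrow> henkin_asser (full_structure I)"
  by (auto simp: henkin_asser_def predicate_structure_def full_structure_def)

text \<open>Choice in the metatheory picks the witnesses, and the full structure contains the
  relation that codes them.\<close>

lemma full_structure_choice_h11:
  assumes "\<gamma> \<in> choice_h11"
  shows "full_structure I \<Turnstile> \<gamma>"
proof (rule models_choice_h11I[OF _ assms])
  fix \<Phi> :: "'a \<Rightarrow> 'a list set \<Rightarrow> bool"
  assume "\<forall>a\<in>indiv (full_structure I). \<exists>\<delta>\<in>preds (full_structure I) 1. \<Phi> a \<delta>"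
  then have "\<forall>a\<in>I. \<exists>\<delta>. \<delta> \<subseteq> tuples I 1 \<and> \<Phi> a \<delta>"
    by (auto simp: full_structure_def)
  then obtain d where d: "\<forall>a\<in>I. d a \<subseteq> tuples I 1 \<and> \<Phi> a (d a)"
    by (rule bchoice[THEN exE])
  define \<sigma> where "\<sigma> = {[a, b] | a b. a \<in> I \<and> b \<in> I \<and> [b] \<in> d a}"
  have "\<sigma> \<in> preds (full_structure I) 2"
    by (auto simp: full_structure_def tuples_def \<sigma>_def)
  moreover have "\<exists>\<delta>\<in>preds (full_structure I) 1.
      (\<forall>b\<in>indiv (full_structure I). [b] \<in> \<delta> \<longleftrightarrow> [a, b] \<in> \<sigma>) \<and> \<Phi> a \<delta>"
    if "a \<in> indiv (full_structure I)" for a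
  proof (rule bexI[of _ "d a"])
    show "d a \<in> preds (full_structure I) 1"
      using d that by (simp add: full_structure_def)
    show "(\<forall>b\<in>indiv (full_structure I). [b] \<in> d a \<longleftrightarrow> [a, b] \<in> \<sigma>) \<and> \<Phi> a (d a)"
      using d that by (simp add: full_structure_def \<sigma>_def)
  qed
  ultimately show "\<exists>\<sigma>\<in>preds (full_structure I) 2. \<forall>a\<in>indiv (full_structure I).
      \<exists>\<delta>\<in>preds (full_structure I) 1.
        (\<forall>b\<in>indiv (full_structure I). [b] \<in> \<delta> \<longleftrightarrow> [a, b] \<in> \<sigma>) \<and> \<Phi> a \<delta>"
    by blast
qed

text \<open>There is only one \<open>n\<close>-tuple, so any two predicates are comparable by
  inclusion.\<close>

lemma full_structure_singleton_TR:
  assumes "n \<ge> 1"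
  shows "full_structure {a} \<Turnstile> TR n"
proof -
  let ?M = "full_structure {a}"
  have tup: "tuples {a} n = {replicate n a}"
    by (auto simp: tuples_def intro!: replicate_eqI)
  have emb: "embeds ?M n \<alpha> \<beta>" if "\<alpha> \<subseteq> \<beta>" "\<beta> \<subseteq> {replicate n a}" for \<alpha> \<beta>
    unfolding embeds_def
  proof (intro bexI conjI)
    \<comment> \<open>With at most one tuple available, the total relation is already the graph of
      the inclusion.\<close>
    show "tuples {a} (2 * n) \<in> preds ?M (2 * n)" by (simp add: full_structure_def)
    have "replicate n a @ replicate n a \<in> tuples {a} (2 * n)" by (auto simp: tuples_def)
    then show "\<forall>\<xi>\<in>\<alpha>. \<exists>!\<eta>. \<eta> \<in> \<beta> \<and> \<xi> @ \<eta> \<in> tuples {a} (2 * n)" using that by blast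
  qed (use that in blast)
  have "predicate_structure ?M"
    by (auto simp: predicate_structure_def full_structure_def)
  moreover have "embeds ?M n \<alpha> \<beta> \<or> embeds ?M n \<beta> \<alpha>"
    if "\<alpha> \<subseteq> {replicate n a}" "\<beta> \<subseteq> {replicate n a}" for \<alpha> \<beta>
    using emb[of \<alpha> \<beta>] emb[of \<beta> \<alpha>] that by (auto simp: subset_singleton_iff)
  ultimately show ?thesis
    using assms tup by (simp add: models_def sat_TR) (simp add: full_structure_def)
qed

section \<open>Finitely supported predicates on coloured individuals\<close>

text \<open>These transpositions generate all finitary colour-preserving permutations that fix
  \<open>P\<close> pointwise, so this is the notion of support from Fraenkel-Mostowski permutation
  models.\<close>

definition supports :: "('a \<Rightarrow> 'k) \<Rightarrow> 'a set \<Rightarrow> 'a list set \<Rightarrow> bool" where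
  "supports c P R \<longleftrightarrow>
     (\<forall>u v. u \<notin> P \<longrightarrow> v \<notin> P \<longrightarrow> c u = c v \<longrightarrow> map (transpose u v) ` R = R)"

definition fraenkel :: "('a \<Rightarrow> 'k) \<Rightarrow> 'a pstruct" where
  "fraenkel c = \<lparr>indiv = UNIV,
     preds = \<lambda>n. {R. R \<subseteq> tuples UNIV n \<and> (\<exists>P. finite P \<and> supports c P R)}\<rparr>"

lemma indiv_fraenkel [simp]: "indiv (fraenkel c) = UNIV"
  by (simp add: fraenkel_def)

lemma preds_fraenkel:
  "R \<in> preds (fraenkel c) n \<longleftrightarrow> R \<subseteq> tuples UNIV n \<and> (\<exists>P. finite P \<and> supports c P R)"
  by (simp add: fraenkel_def)

lemma apply_transpose_eq: "f u = f v \<Longrightarrow> f (transpose u v x) = f x"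
  by (cases "x = u"; cases "x = v") simp_all

text \<open>A transposition is an involution, so closure in one direction gives equality.\<close>

lemma image_map_transpose_eqI:
  assumes "\<And>\<xi>. \<xi> \<in> R \<Longrightarrow> map (transpose u v) \<xi> \<in> R"
  shows "map (transpose u v) ` R = R"
proof
  show "R \<subseteq> map (transpose u v) ` R"
  proof
    fix \<xi> assume "\<xi> \<in> R"
    then show "\<xi> \<in> map (transpose u v) ` R"
      by (intro image_eqI[where x = "map (transpose u v) \<xi>"] assms) simp_all
  qed
qed (use assms in auto)

lemma supportsD:
  assumes "supports c P R" "u \<notin> P" "v \<notin> P" "c u = c v"
  shows "map (transpose u v) ` R = R"
  using assms by (simp add: supports_def)

lemma supports_mono: "supports c P R \<Longrightarrow> P \<subseteq> Q \<Longrightarrow> supports c Q R"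
  by (auto simp: supports_def)

text \<open>Conjugation: moving \<open>transpose s t\<close> past \<open>transpose u v\<close> turns
  it into the transposition of the images of \<open>s\<close> and \<open>t\<close>, which avoid
  \<open>P\<close> and still share a colour.\<close>

lemma supports_map_transpose:
  assumes "supports c P R" "c u = c v"
  shows "supports c (transpose u v ` P) (map (transpose u v) ` R)"
  unfolding supports_def
proof (intro allI impI)
  let ?\<pi> = "transpose u v"
  fix s t assume st: "s \<notin> ?\<pi> ` P" "t \<notin> ?\<pi> ` P" "c s = c t"
  have "transpose s t \<circ> ?\<pi> = ?\<pi> \<circ> transpose (?\<pi> s) (?\<pi> t)"
    using transpose_comp_eq[of ?\<pi> s t] by simp
  then have "map (transpose s t) ` map ?\<pi> ` R = map ?\<pi> ` map (transpose (?\<pi> s) (?\<pi> t)) ` R"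
    by (simp add: image_image)
  moreover have "map (transpose (?\<pi> s) (?\<pi> t)) ` R = R"
  proof (rule supportsD[OF assms(1)])
    show "?\<pi> s \<notin> P" "?\<pi> t \<notin> P"
      using st(1,2) by (simp_all add: in_transpose_image_iff)
    show "c (?\<pi> s) = c (?\<pi> t)"
      using st(3) apply_transpose_eq[of c, OF assms(2)] by simp
  qed
  ultimately show "map (transpose s t) ` map ?\<pi> ` R = map ?\<pi> ` R" by (simp only:)
qed

lemma fraenkel_map_transpose:
  assumes "R \<in> preds (fraenkel c) n" "c u = c v"
  shows "map (transpose u v) ` R \<in> preds (fraenkel c) n"
proof -
  obtain P where "finite P" "supports c P R" using assms(1) by (auto simp: preds_fraenkel)
  then have "finite (transpose u v ` P)" by simp
  moreover have "supports c (transpose u v ` P) (map (transpose u v) ` R)"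
    using supports_map_transpose[of c P R, OF \<open>supports c P R\<close> assms(2)] .
  moreover have "map (transpose u v) ` R \<subseteq> tuples UNIV n"
    using assms(1) by (auto simp: preds_fraenkel tuples_def)
  ultimately show ?thesis unfolding preds_fraenkel by blast
qed

text \<open>Here \<open>u\<close> and \<open>v\<close> may lie in the support of a predicate: the
  support is then moved along with the predicate.\<close>

lemma automorphism_transpose:
  assumes "c u = c v"
  shows "automorphism (fraenkel c) (transpose u v)"
  unfolding automorphism_def
proof (intro conjI allI)
  let ?act = "(`) (map (transpose u v))" and ?J = "preds (fraenkel c)"
  fix n
  have closed: "?act R \<in> ?J n" if "R \<in> ?J n" for R
    using that assms by (rule fraenkel_map_transpose)
  have "R \<in> ?act ` ?J n" if "R \<in> ?J n" for R
  proof (rule image_eqI)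
    show "R = ?act (?act R)" by (simp add: image_image)
  qed (use closed[OF that] in simp)
  then show "?act ` ?J n = ?J n" using closed by blast
qed simp_all

lemma predicate_structure_fraenkel: "predicate_structure (fraenkel c)"
proof -
  have "{} \<in> preds (fraenkel c) n" for n
    by (auto simp: preds_fraenkel supports_def)
  then have "preds (fraenkel c) n \<noteq> {}" for n by blast
  then show ?thesis by (auto simp: predicate_structure_def preds_fraenkel)
qed

text \<open>Only finitely many variables are free, so finitely many values and supports are united.
  Well-formedness excludes sort 0, about which \<open>assignment\<close> says nothing.\<close>

lemma common_support:
  assumes "assignment (fraenkel c) e p" "wff \<phi>"
  obtains P where "finite P" "\<And>x. x \<in> free_ivars \<phi> \<Longrightarrow> e x \<in> P"
    "\<And>A. A \<in> free_pvars \<phi> \<Longrightarrow> supports c P (p A)"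
proof -
  have "\<exists>Q. finite Q \<and> supports c Q (p A)" if "A \<in> free_pvars \<phi>" for A
    using assms(1) psort_free_pvars[OF assms(2) that] by (auto simp: assignment_def preds_fraenkel)
  then obtain Q where "\<And>A. A \<in> free_pvars \<phi> \<Longrightarrow> finite (Q A) \<and> supports c (Q A) (p A)"
    by metis
  then show ?thesis
    using that[of "e ` free_ivars \<phi> \<union> (\<Union>A\<in>free_pvars \<phi>. Q A)"]
    by (auto simp: finite_free_ivars finite_free_pvars intro: supports_mono)
qed

text \<open>A common support of the parameters also supports the predicate they define.\<close>

lemma henkin_asser_fraenkel: "henkin_asser (fraenkel c)"
  unfolding henkin_asser_def
proof (intro conjI ballI allI impI predicate_structure_fraenkel)
  fix H xs e p
  assume "H \<in> L2" and asg: "assignment (fraenkel c) e p"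
  then obtain P where P: "finite P" "\<And>x. x \<in> free_ivars H \<Longrightarrow> e x \<in> P"
      "\<And>A. A \<in> free_pvars H \<Longrightarrow> supports c P (p A)"
    using common_support[OF asg, of H] by (auto simp: L2_def)
  let ?R = "{\<xi> \<in> tuples (indiv (fraenkel c)) (length xs). sat (fraenkel c) (upds e xs \<xi>) p H}"
  have "supports c P ?R"
    unfolding supports_def
  proof (intro allI impI image_map_transpose_eqI)
    fix u v \<xi> assume uv: "u \<notin> P" "v \<notin> P" "c u = c v" and \<xi>: "\<xi> \<in> ?R"
    have "transpose u v (e x) = e x" if "x \<in> free_ivars H" for x
      using P(2)[OF that] uv by (auto simp: transpose_def)
    then have "sat (fraenkel c) (upds e xs (map (transpose u v) \<xi>)) p H
        \<longleftrightarrow> sat (fraenkel c) (upds e xs \<xi>) p H"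
      using \<xi> P(3) uv by (intro sat_automorphism[OF automorphism_transpose[of c u v]] upds_map)
        (simp_all add: supportsD[OF P(3)] tuples_def)
    then show "map (transpose u v) \<xi> \<in> ?R" using \<xi> by (auto simp: tuples_def)
  qed
  then show "?R \<in> preds (fraenkel c) (length xs)"
    using P(1) by (auto simp: preds_fraenkel)
qed

section \<open>Choice holds for finitely supported predicates\<close>

text \<open>One witness per colour, transported by equivariance, serves almost all individuals; as
  there are finitely many colours, the exceptional set stays finite.\<close>

lemma fraenkel_uniform_choice:
  fixes c :: "'a \<Rightarrow> 'k :: finite"
  assumes inf: "\<And>k. infinite {a. c a = k}"
    and "finite P"
    and ex: "\<And>a. \<exists>\<delta>\<in>preds (fraenkel c) 1. \<Phi> a \<delta>"
    and equivariant: "\<And>a \<delta> u v. \<lbrakk>u \<notin> P; v \<notin> P; c u = c v; \<Phi> a \<delta>\<rbrakk> \<Longrightarrow>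
      \<Phi> (transpose u v a) (map (transpose u v) ` \<delta>)"
  shows "\<exists>\<sigma>\<in>preds (fraenkel c) 2. \<forall>a. \<exists>\<delta>\<in>preds (fraenkel c) 1.
    (\<forall>b. [b] \<in> \<delta> \<longleftrightarrow> [a, b] \<in> \<sigma>) \<and> \<Phi> a \<delta>"
proof -
  obtain d where d: "\<And>a. d a \<in> preds (fraenkel c) 1" "\<And>a. \<Phi> a (d a)"
    using ex by metis
  obtain Q where Q: "\<And>a. finite (Q a)" "\<And>a. supports c (Q a) (d a)"
    using d(1) unfolding preds_fraenkel by metis
  \<comment> \<open>\<open>r k\<close> is the representative of colour \<open>k\<close>; it avoids
    \<open>P\<close> so that equivariance applies to its transposition with other points outside
    \<open>P\<close>.\<close>
  obtain r where r: "\<And>k. c (r k) = k" "\<And>k. r k \<notin> P"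
  proof -
    have "\<exists>a. c a = k \<and> a \<notin> P" for k
      using inf[of k] assms(2) by (metis (mono_tags, lifting) finite_subset mem_Collect_eq subsetI)
    then show ?thesis using that by metis
  qed
  \<comment> \<open>\<open>K\<close> collects the exceptional individuals, which keep their own
    witnesses: parameters, representatives, and supports of the representatives' witnesses.
    \<open>T\<close> adds the supports of the witnesses used on \<open>K\<close> and will support
    \<open>\<sigma>\<close>.\<close>
  define K where "K = P \<union> range r \<union> (\<Union>k. Q (r k))"
  define T where "T = K \<union> (\<Union>a\<in>K. Q a)"
  define D where "D a = (if a \<in> K then d a
    else map (transpose (r (c a)) a) ` d (r (c a)))" for a
  have "finite K" using assms(2) Q(1) by (simp add: K_def)
  then have "finite T" using Q(1) by (simp add: T_def)
  have D_preds: "D a \<in> preds (fraenkel c) 1" for a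
    using d(1) r(1) by (auto simp: D_def intro!: fraenkel_map_transpose)
  have D_\<Phi>: "\<Phi> a (D a)" for a
  proof (cases "a \<in> K")
    case True
    then show ?thesis by (simp add: D_def d(2))
  next
    case False
    then have "a \<notin> P" by (simp add: K_def)
    then show ?thesis
      using equivariant[of "r (c a)" a "r (c a)" "d (r (c a))"] r d(2) False by (simp add: D_def)
  qed
  \<comment> \<open>Equivariance of \<open>D\<close> outside \<open>T\<close> is what makes
    \<open>T\<close> a support of \<open>\<sigma>\<close>.\<close>
  have D_transpose: "D (transpose u v a) = map (transpose u v) ` D a"
    if uv: "u \<notin> T" "v \<notin> T" "c u = c v" for u v a
  proof -
    let ?r = "r (c u)" and ?s = "r (c a)"
    have "u \<notin> K" "v \<notin> K" using uv by (auto simp: T_def)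
    have away: "u \<notin> Q (r k)" "v \<notin> Q (r k)" "u \<noteq> r k" "v \<noteq> r k" for k
      using \<open>u \<notin> K\<close> \<open>v \<notin> K\<close> by (auto simp: K_def)
    then have fixed: "map (transpose u v) ` d (r k) = d (r k)" for k
      using supportsD[OF Q(2)] uv(3) by metis
    \<comment> \<open>Both \<open>D s\<close> and \<open>D t\<close> are copies of
      \<open>d ?r\<close>. Conjugation turns \<open>transpose ?r s\<close> into
      \<open>transpose ?r t\<close>, and \<open>transpose s t\<close> fixes \<open>d ?r\<close>. The
      unordered pair covers both \<open>a = u\<close> and \<open>a = v\<close>.\<close>
    have swapped: "D t = map (transpose s t) ` D s"
      if "{s, t} = {u, v}" "s \<noteq> t" for s t
    proof -
      have st: "s \<notin> K" "t \<notin> K" "c s = c u" "c t = c u" "s \<noteq> ?r" "t \<noteq> ?r"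
        using that uv(3) \<open>u \<notin> K\<close> \<open>v \<notin> K\<close> away(3,4)[of "c u"]
        by (auto simp: doubleton_eq_iff)
      have "transpose s t = transpose u v"
        using that by (auto simp: doubleton_eq_iff transpose_commute)
      have "transpose ?r t \<circ> transpose s t = transpose s t \<circ> transpose ?r s"
        using st(5,6) \<open>s \<noteq> t\<close> transpose_comp_eq[of "transpose s t" ?r t] by simp
      then have "map (transpose s t) ` map (transpose ?r s) ` d ?r
          = map (transpose ?r t) ` map (transpose s t) ` d ?r"
        by (simp add: image_image)
      then show ?thesis
        using st fixed \<open>transpose s t = transpose u v\<close> by (simp add: D_def)
    qed
    consider "u = v" | "u \<noteq> v" "a = u" | "u \<noteq> v" "a = v" | "a \<noteq> u" "a \<noteq> v" "a \<in> K"
      | "a \<noteq> u" "a \<noteq> v" "a \<notin> K" by blast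
    then show ?thesis
    proof cases
      case 1
      then show ?thesis by simp
    next
      case 2
      then show ?thesis using swapped[of u v] by simp
    next
      case 3
      then show ?thesis using swapped[of v u] by (simp add: insert_commute transpose_commute)
    next
      case 4
      \<comment> \<open>Here \<open>a\<close> is fixed and keeps its own witness, whose support lies
        in \<open>T\<close>.\<close>
      then have "u \<notin> Q a" "v \<notin> Q a" using uv by (auto simp: T_def)
      then show ?thesis using 4 supportsD[OF Q(2)] uv(3) by (simp add: D_def)
    next
      case 5
      \<comment> \<open>The two transpositions are disjoint and hence commute, while
        \<open>d ?s\<close> is fixed.\<close>
      have "u \<noteq> ?s" "v \<noteq> ?s" using \<open>u \<notin> K\<close> \<open>v \<notin> K\<close> by (auto simp: K_def)
      then have "transpose u v \<circ> transpose ?s a = transpose ?s a \<circ> transpose u v"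
        using 5 transpose_comp_eq[of "transpose u v" ?s a] by simp
      then have "map (transpose u v) ` map (transpose ?s a) ` d ?s
          = map (transpose ?s a) ` map (transpose u v) ` d ?s"
        by (simp add: image_image)
      then show ?thesis using 5 fixed by (simp add: D_def)
    qed
  qed
  define \<sigma> where "\<sigma> = {[a, b] | a b. [b] \<in> D a}"
  have "supports c T \<sigma>"
    unfolding supports_def
  proof (intro allI impI image_map_transpose_eqI)
    fix u v \<xi> assume uv: "u \<notin> T" "v \<notin> T" "c u = c v" and "\<xi> \<in> \<sigma>"
    then obtain a b where ab: "\<xi> = [a, b]" "[b] \<in> D a" by (auto simp: \<sigma>_def)
    then have "map (transpose u v) [b] \<in> D (transpose u v a)"
      unfolding D_transpose[OF uv] by (intro imageI)
    then show "map (transpose u v) \<xi> \<in> \<sigma>" by (simp add: ab(1) \<sigma>_def)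
  qed
  then have "\<sigma> \<in> preds (fraenkel c) 2"
    using \<open>finite T\<close> by (auto simp: preds_fraenkel \<sigma>_def tuples_def)
  then show ?thesis
    using D_preds D_\<Phi> by (intro bexI[of _ \<sigma>]) (auto simp: \<sigma>_def)
qed

lemma fraenkel_choice_h11:
  fixes c :: "'a \<Rightarrow> 'k :: finite"
  assumes "\<And>k. infinite {a. c a = k}" "\<gamma> \<in> choice_h11"
  shows "fraenkel c \<Turnstile> \<gamma>"
proof (rule models_choice_h11I[OF _ assms(2)])
  fix \<Phi> H e p x D
  assume asg: "assignment (fraenkel c) e p" and "psort D = 1" "H \<in> L2"
    and \<Phi>: "\<Phi> = (\<lambda>a \<delta>. sat (fraenkel c) (e(x := a)) (p(D := \<delta>)) H)"
    and ex: "\<forall>a\<in>indiv (fraenkel c). \<exists>\<delta>\<in>preds (fraenkel c) 1. \<Phi> a \<delta>"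
  then obtain P where P: "finite P" "\<And>x. x \<in> free_ivars H \<Longrightarrow> e x \<in> P"
      "\<And>A. A \<in> free_pvars H \<Longrightarrow> supports c P (p A)"
    using common_support[OF asg, of H] by (auto simp: L2_def)
  have "\<Phi> (transpose u v a) (map (transpose u v) ` \<delta>)"
    if uv: "u \<notin> P" "v \<notin> P" "c u = c v" "\<Phi> a \<delta>" for a \<delta> u v
  proof -
    \<comment> \<open>\<open>P\<close> belongs to the original \<open>e\<close> and
      \<open>p\<close>: the parameters stay fixed, while the new values \<open>a\<close> and
      \<open>\<delta>\<close> of \<open>x\<close> and \<open>D\<close> are moved.\<close>
    have "transpose u v (e y) = e y" if "y \<in> free_ivars H" for y
      using P(2)[OF that] uv by (auto simp: transpose_def)
    then have "\<Phi> (transpose u v a) (map (transpose u v) ` \<delta>) \<longleftrightarrow> \<Phi> a \<delta>"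
      unfolding \<Phi> using P(3) uv
      by (intro sat_automorphism[OF automorphism_transpose[of c u v]])
        (simp_all add: supportsD[OF P(3)])
    then show ?thesis using uv(4) by simp
  qed
  then show "\<exists>\<sigma>\<in>preds (fraenkel c) 2. \<forall>a\<in>indiv (fraenkel c). \<exists>\<delta>\<in>preds (fraenkel c) 1.
      (\<forall>b\<in>indiv (fraenkel c). [b] \<in> \<delta> \<longleftrightarrow> [a, b] \<in> \<sigma>) \<and> \<Phi> a \<delta>"
    using fraenkel_uniform_choice[of c P \<Phi>] assms(1) P(1) ex by simp
qed

section \<open>Trichotomy fails for finitely supported predicates\<close>

text \<open>Constant tuples copy a colour class into sort \<open>n\<close>, so one argument refutes
  trichotomy in every arity.\<close>

definition diagonal_class :: "('a \<Rightarrow> 'k) \<Rightarrow> nat \<Rightarrow> 'k \<Rightarrow> 'a list set" where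
  "diagonal_class c n k = {replicate n a | a. c a = k}"

lemma diagonal_class_in_preds: "diagonal_class c n k \<in> preds (fraenkel c) n"
proof -
  have "supports c {} (diagonal_class c n k)"
    unfolding supports_def
  proof (intro allI impI image_map_transpose_eqI)
    fix u v \<xi> assume uv: "c u = c v" and "\<xi> \<in> diagonal_class c n k"
    then obtain a where a: "\<xi> = replicate n a" "c a = k" by (auto simp: diagonal_class_def)
    have "c (transpose u v a) = k" using apply_transpose_eq[of c, OF uv] a(2) by simp
    then show "map (transpose u v) \<xi> \<in> diagonal_class c n k"
      using a(1) by (auto simp: diagonal_class_def)
  qed
  then show ?thesis by (auto simp: preds_fraenkel diagonal_class_def tuples_def)
qed

text \<open>Swapping two points of colour \<open>k\<close> outside the support of the alleged
  injection changes an argument but fixes its value, which has another colour.\<close>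

lemma not_embeds_diagonal_class:
  assumes "infinite {a. c a = k}" "k \<noteq> l" "n \<ge> 1"
  shows "\<not> embeds (fraenkel c) n (diagonal_class c n k) (diagonal_class c n l)"
proof
  let ?\<alpha> = "diagonal_class c n k" and ?\<beta> = "diagonal_class c n l"
  assume "embeds (fraenkel c) n ?\<alpha> ?\<beta>"
  then obtain \<rho> where \<rho>: "\<rho> \<in> preds (fraenkel c) (2 * n)"
      "\<And>\<xi>. \<xi> \<in> ?\<alpha> \<Longrightarrow> \<exists>\<eta>. \<eta> \<in> ?\<beta> \<and> \<xi> @ \<eta> \<in> \<rho>"
      "\<And>\<xi> \<xi>' \<eta>. \<lbrakk>\<xi> \<in> ?\<alpha>; \<xi>' \<in> ?\<alpha>; \<eta> \<in> ?\<beta>; \<xi> @ \<eta> \<in> \<rho>; \<xi>' @ \<eta> \<in> \<rho>\<rbrakk> \<Longrightarrow> \<xi> = \<xi>'"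
    unfolding embeds_def by metis
  from \<rho>(1) obtain P where P: "finite P" "supports c P \<rho>" by (auto simp: preds_fraenkel)
  have inf: "infinite ({a. c a = k} - P)" using assms(1) P(1) by simp
  then obtain u where u: "c u = k" "u \<notin> P"
    using infinite_imp_nonempty by blast
  have "infinite ({a. c a = k} - P - {u})" using inf by simp
  then obtain v where v: "c v = k" "v \<notin> P" "v \<noteq> u"
    using infinite_imp_nonempty by blast
  have \<alpha>: "replicate n u \<in> ?\<alpha>" "replicate n v \<in> ?\<alpha>"
    using u v by (auto simp: diagonal_class_def)
  obtain w where w: "c w = l" "replicate n u @ replicate n w \<in> \<rho>"
    using \<rho>(2)[OF \<alpha>(1)] by (auto simp: diagonal_class_def)
  have "map (transpose u v) (replicate n u @ replicate n w) \<in> \<rho>"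
    using supportsD[OF P(2) u(2) v(2)] u(1) v(1) w(2) by (metis imageI)
  moreover have "transpose u v w = w"
    using w(1) u(1) v(1) assms(2) by (auto simp: transpose_def)
  ultimately have "replicate n v @ replicate n w \<in> \<rho>" by simp
  moreover have "replicate n w \<in> ?\<beta>" using w(1) by (auto simp: diagonal_class_def)
  ultimately have "replicate n u = replicate n v"
    using \<rho>(3) \<alpha> w(2) by blast
  then show False using v(3) assms(3) by simp
qed

lemma fraenkel_not_TR:
  fixes c :: "'a \<Rightarrow> 'k" and k l :: 'k
  assumes "\<And>k. infinite {a. c a = k}" "k \<noteq> l" "n \<ge> 1"
  shows "fraenkel c \<Turnstile> Neg (TR n)"
  using diagonal_class_in_preds[of c n k] diagonal_class_in_preds[of c n l]
    not_embeds_diagonal_class[OF assms(1) assms(2) assms(3)]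
    not_embeds_diagonal_class[OF assms(1) assms(2)[symmetric] assms(3)]
  by (auto simp: models_def sat_TR[OF predicate_structure_fraenkel assms(3)])

section \<open>A two-colouring of the individuals and the assembly of both models\<close>

lemma ex_two_colouring: "\<exists>c :: 'a :: infinite \<Rightarrow> bool. \<forall>k. infinite {a. c a = k}"
proof -
  obtain f :: "nat \<Rightarrow> 'a" where "inj f"
    using infinite_UNIV infinite_countable_subset by blast
  \<comment> \<open>Even terms of the sequence get one colour; the odd terms and all remaining
    individuals get the other.\<close>
  define c where "c a \<longleftrightarrow> a \<in> range (\<lambda>m. f (2 * m))" for a
  have "{a. c a = k} \<supseteq> range (\<lambda>m. f (2 * m + (if k then 0 else 1)))" for k
  proof (cases k)
    case False
    have "2 * m + 1 \<noteq> 2 * m'" for m m' :: nat by presburger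
    then show ?thesis using False \<open>inj f\<close> by (auto simp: c_def inj_eq)
  qed (auto simp: c_def)
  moreover have "infinite (range (\<lambda>m. f (2 * m + j)))" for j
  proof -
    have "inj (\<lambda>m. f (2 * m + j))" using \<open>inj f\<close> by (intro injI) (auto dest: injD)
    then show ?thesis by (simp add: finite_image_iff)
  qed
  ultimately show ?thesis by (metis finite_subset)
qed

lemma hpl_independentI:
  fixes M N :: "'a pstruct"
  assumes "sentence \<psi>"
    and "henkin_asser M" "\<And>\<gamma>. \<gamma> \<in> \<Gamma> \<Longrightarrow> M \<Turnstile> \<gamma>" "M \<Turnstile> \<psi>"
    and "henkin_asser N" "\<And>\<gamma>. \<gamma> \<in> \<Gamma> \<Longrightarrow> N \<Turnstile> \<gamma>" "N \<Turnstile> Neg \<psi>"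
  shows "hpl_independent TYPE('a) \<Gamma> \<psi>"
proof -
  \<comment> \<open>A formula and its negation could both hold vacuously if there were no
    assignment; non-empty domains in all sorts supply one.\<close>
  have contra: "\<not> (L \<Turnstile> \<phi> \<and> L \<Turnstile> Neg \<phi>)" if "henkin_asser L" for L :: "'a pstruct" and \<phi>
  proof -
    have "indiv L \<noteq> {}"
      using that by (simp add: henkin_asser_def predicate_structure_def)
    then obtain a where "a \<in> indiv L" by blast
    moreover have "(SOME \<alpha>. \<alpha> \<in> preds L n) \<in> preds L n" if "n \<ge> 1" for n
      using that \<open>henkin_asser L\<close>
      by (simp add: henkin_asser_def predicate_structure_def some_in_eq)
    ultimately have "assignment L (\<lambda>_. a) (\<lambda>A. SOME \<alpha>. \<alpha> \<in> preds L (psort A))"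
      by (simp add: assignment_def)
    then show ?thesis unfolding models_def by auto
  qed
  show ?thesis
    using assms contra unfolding hpl_independent_def hpl_consequence_def by blast
qed

theorem proposition4p5:
  fixes n :: nat
  assumes "n \<ge> 1"
  shows "hpl_independent TYPE('a :: infinite) choice_h11 (TR n)"
proof -
  obtain c :: "'a \<Rightarrow> bool" where c: "\<And>k. infinite {a. c a = k}"
    using ex_two_colouring by blast
  show ?thesis
  proof (rule hpl_independentI)
    show "fraenkel c \<Turnstile> Neg (TR n)"
      using fraenkel_not_TR[of c True False n] c assms by simp
    show "full_structure {undefined :: 'a} \<Turnstile> TR n"
      using assms by (rule full_structure_singleton_TR)
  qed (use assms c in \<open>simp_all add: sentence_TR henkin_asser_full_structure
      full_structure_choice_h11 henkin_asser_fraenkel fraenkel_choice_h11\<close>)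
qed

end
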